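(* If $G$ is a $3$-free digraph on $n$ vertices, then $P_4(G) \leq \frac{4}{75}n^4$.
   Context: Digraphs are finite, loopless, with at most one edge $uv$ per ordered pair. A digraph is $3$-free if it has no directed cycle of length at most $3$. $P_4(G)$ is the number of directed paths with $4$ vertices in $G$, i.e. the number of sequences $(v_1,v_2,v_3,v_4)$ of distinct vertices with $v_iv_{i+1}\in E(G)$ for $i=1,2,3$. *)

theory Defs
  imports Complex_Main
begin

definition digraph :: "'a set \<Rightarrow> ('a \<times> 'a) set \<Rightarrow> bool" where
  "digraph V E \<longleftrightarrow> finite V \<and> E \<subseteq> V \<times> V \<and> (\<forall>v. (v, v) \<notin> E)"

definition three_free :: "'a set \<Rightarrow> ('a \<times> 'a) set \<Rightarrow> bool" where
  "three_free V E \<longleftrightarrow>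
     (\<forall>u\<in>V. (u, u) \<notin> E) \<and>
     (\<forall>u\<in>V. \<forall>v\<in>V. u \<noteq> v \<longrightarrow> \<not> ((u, v) \<in> E \<and> (v, u) \<in> E)) \<and>
     (\<forall>u\<in>V. \<forall>v\<in>V. \<forall>w\<in>V. distinct [u, v, w] \<longrightarrow>
        \<not> ((u, v) \<in> E \<and> (v, w) \<in> E \<and> (w, u) \<in> E))"

definition P4 :: "'a set \<Rightarrow> ('a \<times> 'a) set \<Rightarrow> nat" where
  "P4 V E = card {(a, b, c, d). a \<in> V \<and> b \<in> V \<and> c \<in> V \<and> d \<in> V \<and>
      distinct [a, b, c, d] \<and> (a, b) \<in> E \<and> (b, c) \<in> E \<and> (c, d) \<in> E}"

end

theory Submission
  imports Defs
begin

text \<open>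
  Sum two squares over ordered pairs of vertices. For an arc \<open>u \<rightarrow> v\<close>, square the number of \<open>x\<close>
  such that \<open>x u v\<close> is an induced path minus the number of \<open>x\<close> such that \<open>u v x\<close> is one.
  For a nonadjacent pair \<open>u, v\<close>, square the number of \<open>x\<close> adjacent to exactly one of \<open>u, v\<close> minus
  the number of \<open>x\<close> lying on a path \<open>u x v\<close> or \<open>v x u\<close>. Expanded over quadruples of vertices and
  added with weights 18 and 3 to 44 times the indicator of a 4-vertex path, they give a function
  whose sum over the 24 orderings of any quadruple is at most 56. On four vertices a 3-free
  digraph is either acyclic or an induced 4-cycle, so this is a check of 65 cases. As the squares are
  nonnegative, the number of paths is at most
  \<open>56 / (24 * 44) * n^4 = 7/132 * n^4\<close>, which is slightly below \<open>4/75 * n^4\<close>.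

  Quadruples with repetitions need no separate treatment: equal entries behave like nonadjacent
  vertices.
\<close>

definition nonadj :: "('a \<Rightarrow> 'a \<Rightarrow> bool) \<Rightarrow> 'a \<Rightarrow> 'a \<Rightarrow> bool" where
  "nonadj r x y \<longleftrightarrow> \<not> r x y \<and> \<not> r y x"

definition path4 :: "('a \<Rightarrow> 'a \<Rightarrow> bool) \<Rightarrow> 'a \<Rightarrow> 'a \<Rightarrow> 'a \<Rightarrow> 'a \<Rightarrow> real" where
  "path4 r a b c d = (if r a b \<and> r b c \<and> r c d then 1 else 0)"

definition arc_weight :: "('a \<Rightarrow> 'a \<Rightarrow> bool) \<Rightarrow> 'a \<Rightarrow> 'a \<Rightarrow> 'a \<Rightarrow> real" where
  "arc_weight r u v x =
     (if r x u \<and> nonadj r x v then 1 else if r v x \<and> nonadj r u x then -1 else 0)"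

definition nonarc_weight :: "('a \<Rightarrow> 'a \<Rightarrow> bool) \<Rightarrow> 'a \<Rightarrow> 'a \<Rightarrow> 'a \<Rightarrow> real" where
  "nonarc_weight r u v x =
     (if nonadj r u x \<noteq> nonadj r v x then 1
      else if r u x \<and> r x v \<or> r v x \<and> r x u then -1 else 0)"

definition arc_square :: "('a \<Rightarrow> 'a \<Rightarrow> bool) \<Rightarrow> 'a \<Rightarrow> 'a \<Rightarrow> 'a \<Rightarrow> 'a \<Rightarrow> real" where
  "arc_square r u v x y = (if r u v then arc_weight r u v x * arc_weight r u v y else 0)"

definition nonarc_square :: "('a \<Rightarrow> 'a \<Rightarrow> bool) \<Rightarrow> 'a \<Rightarrow> 'a \<Rightarrow> 'a \<Rightarrow> 'a \<Rightarrow> real" where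
  "nonarc_square r u v x y =
     (if nonadj r u v then nonarc_weight r u v x * nonarc_weight r u v y else 0)"

definition certificate :: "('a \<Rightarrow> 'a \<Rightarrow> bool) \<Rightarrow> 'a \<Rightarrow> 'a \<Rightarrow> 'a \<Rightarrow> 'a \<Rightarrow> real" where
  "certificate r a b c d =
     44 * path4 r a b c d + 18 * arc_square r a b c d + 3 * nonarc_square r a b c d"

text \<open>The sum over all 24 orderings, factored into insertions so that each factor visibly
  preserves sums over quadruples up to the factors 2, 3 and 4.\<close>

definition insert2 :: "('a \<Rightarrow> 'a \<Rightarrow> 'a \<Rightarrow> 'a \<Rightarrow> real) \<Rightarrow> 'a \<Rightarrow> 'a \<Rightarrow> 'a \<Rightarrow> 'a \<Rightarrow> real" where
  "insert2 g a b c d = g a b c d + g a b d c"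

definition insert3 :: "('a \<Rightarrow> 'a \<Rightarrow> 'a \<Rightarrow> 'a \<Rightarrow> real) \<Rightarrow> 'a \<Rightarrow> 'a \<Rightarrow> 'a \<Rightarrow> 'a \<Rightarrow> real" where
  "insert3 g a b c d = g a b c d + g a c b d + g a c d b"

definition insert4 :: "('a \<Rightarrow> 'a \<Rightarrow> 'a \<Rightarrow> 'a \<Rightarrow> real) \<Rightarrow> 'a \<Rightarrow> 'a \<Rightarrow> 'a \<Rightarrow> 'a \<Rightarrow> real" where
  "insert4 g a b c d = g a b c d + g b a c d + g b c a d + g b c d a"

definition symmetrize :: "('a \<Rightarrow> 'a \<Rightarrow> 'a \<Rightarrow> 'a \<Rightarrow> real) \<Rightarrow> 'a \<Rightarrow> 'a \<Rightarrow> 'a \<Rightarrow> 'a \<Rightarrow> real" where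
  "symmetrize g = insert2 (insert3 (insert4 g))"

definition sum4 :: "'a set \<Rightarrow> ('a \<Rightarrow> 'a \<Rightarrow> 'a \<Rightarrow> 'a \<Rightarrow> real) \<Rightarrow> real" where
  "sum4 V g = (\<Sum>a\<in>V. \<Sum>b\<in>V. \<Sum>c\<in>V. \<Sum>d\<in>V. g a b c d)"

lemma sum4_add: "sum4 V (\<lambda>a b c d. g a b c d + h a b c d) = sum4 V g + sum4 V h"
  by (simp add: sum4_def sum.distrib)

lemma sum4_cmult: "sum4 V (\<lambda>a b c d. k * g a b c d) = k * sum4 V g"
  by (simp add: sum4_def sum_distrib_left)

lemma sum4_swap12: "sum4 V (\<lambda>a b c d. g b a c d) = sum4 V g"
  unfolding sum4_def by (rule sum.swap)

lemma sum4_swap23: "sum4 V (\<lambda>a b c d. g a c b d) = sum4 V g"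
  unfolding sum4_def by (intro sum.cong refl sum.swap)

lemma sum4_swap34: "sum4 V (\<lambda>a b c d. g a b d c) = sum4 V g"
  unfolding sum4_def by (intro sum.cong refl sum.swap)

text \<open>Every term of the three insertion operators is \<open>g\<close> with its arguments
  permuted. Renaming summation variables removes the permutation, leaving the factors 2, 3 and
  4.\<close>

lemma sum4_symmetrize: "sum4 V (symmetrize g) = 24 * sum4 V g"
proof -
  \<comment> \<open>Moving one variable past several others is a chain of adjacent swaps.\<close>
  have move2: "sum4 V (\<lambda>a b c d. g a c d b) = sum4 V g" for g
    using sum4_swap23[of V "\<lambda>a b c d. g a b d c"] sum4_swap34[of V g] by (rule trans)
  have move1_to3: "sum4 V (\<lambda>a b c d. g b c a d) = sum4 V g" for g
    using sum4_swap12[of V "\<lambda>a b c d. g a c b d"] sum4_swap23[of V g] by (rule trans)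
  have move1_to4: "sum4 V (\<lambda>a b c d. g b c d a) = sum4 V g" for g
    using sum4_swap12[of V "\<lambda>a b c d. g a c d b"] move2[of g] by (rule trans)
  have i2: "sum4 V (insert2 g) = 2 * sum4 V g" for g
    unfolding insert2_def sum4_add by (subst sum4_swap34) simp
  have i3: "sum4 V (insert3 g) = 3 * sum4 V g" for g
    unfolding insert3_def sum4_add
    by (simp only: sum4_swap23[of V g] move2[of g])
  have i4: "sum4 V (insert4 g) = 4 * sum4 V g" for g
    unfolding insert4_def sum4_add
    by (simp only: sum4_swap12[of V g] move1_to3[of g] move1_to4[of g])
  show ?thesis unfolding symmetrize_def i2 i3 i4 by simp
qed

text \<open>The condition ignores \<open>x\<close> and \<open>y\<close>, and the two factors are the
  same function of \<open>x\<close> and of \<open>y\<close>; so for fixed \<open>u\<close>,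
  \<open>v\<close> the inner double sum factors into a square.\<close>

lemma sum4_square_nonneg:
  "0 \<le> sum4 V (\<lambda>u v x y. if P u v then w u v x * w u v y else 0)"
proof -
  have "(\<Sum>x\<in>V. \<Sum>y\<in>V. if P u v then w u v x * w u v y else 0)
      = (if P u v then (\<Sum>x\<in>V. w u v x)\<^sup>2 else 0)" for u v
    by (simp add: power2_eq_square sum_product)
  then show ?thesis unfolding sum4_def by (simp add: sum_nonneg)
qed

lemma sum4_mono:
  assumes "\<And>a b c d. a \<in> V \<Longrightarrow> b \<in> V \<Longrightarrow> c \<in> V \<Longrightarrow> d \<in> V \<Longrightarrow> g a b c d \<le> h a b c d"
  shows "sum4 V g \<le> sum4 V h"
  unfolding sum4_def by (intro sum_mono assms)

text \<open>Both sides add the same 24 terms in another order. The three adjacent transpositions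
  treated here and below generate all reorderings.\<close>

lemma symmetrize_swap12: "symmetrize g b a c d = symmetrize g a b c d"
  by (simp only: symmetrize_def insert2_def insert3_def insert4_def add_ac)

lemma symmetrize_swap23: "symmetrize g a c b d = symmetrize g a b c d"
  by (simp only: symmetrize_def insert2_def insert3_def insert4_def add_ac)

lemma symmetrize_swap34: "symmetrize g a b d c = symmetrize g a b c d"
  by (simp only: symmetrize_def insert2_def insert3_def insert4_def add_ac)

text \<open>The acyclic case, with \<open>a b c d\<close> a topological order. The six forward pairs
  remain free, giving 64 digraphs to evaluate.\<close>

lemma symmetrize_certificate_ordered:
  assumes "\<not> r b a" "\<not> r c a" "\<not> r d a" "\<not> r c b" "\<not> r d b" "\<not> r d c"
  shows "symmetrize (certificate r) a b c d \<le> 56"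
  unfolding symmetrize_def insert2_def insert3_def insert4_def certificate_def
    path4_def arc_square_def nonarc_square_def arc_weight_def nonarc_weight_def nonadj_def
  using assms
  by (cases "r a b"; cases "r a c"; cases "r a d"; cases "r b c"; cases "r b d"; cases "r c d"; simp)

text \<open>The induced 4-cycle: all twelve ordered pairs are decided, so one evaluation is
  enough.\<close>

lemma symmetrize_certificate_cyclic:
  assumes "r a b" "r b c" "r c d" "r d a"
    and "\<not> r b a" "\<not> r c b" "\<not> r d c" "\<not> r a d"
    and "\<not> r a c" "\<not> r c a" "\<not> r b d" "\<not> r d b"
  shows "symmetrize (certificate r) a b c d \<le> 56"
  unfolding symmetrize_def insert2_def insert3_def insert4_def certificate_def
    path4_def arc_square_def nonarc_square_def arc_weight_def nonarc_weight_def nonadj_def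
  using assms by simp

text \<open>Without a topological order there is a directed cycle, necessarily through all four
  vertices. A diagonal, in either direction, would close a triangle, so the cycle is
  induced.\<close>

lemma symmetrize_certificate_le:
  assumes V: "a \<in> V" "b \<in> V" "c \<in> V" "d \<in> V"
    and arc: "\<And>x y. x \<in> V \<Longrightarrow> y \<in> V \<Longrightarrow> r x y \<Longrightarrow> \<not> r y x"
    and tri: "\<And>x y z. \<lbrakk>x \<in> V; y \<in> V; z \<in> V; r x y; r y z\<rbrakk> \<Longrightarrow> \<not> r z x"
  shows "symmetrize (certificate r) a b c d \<le> 56"
proof -
  have arcs: "\<not> r a b \<or> \<not> r b a" "\<not> r a c \<or> \<not> r c a" "\<not> r a d \<or> \<not> r d a"
    "\<not> r b c \<or> \<not> r c b" "\<not> r b d \<or> \<not> r d b" "\<not> r c d \<or> \<not> r d c"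
    using arc V by blast+
  have triangles: "\<not> r a b \<or> \<not> r b c \<or> \<not> r c a" "\<not> r a c \<or> \<not> r c b \<or> \<not> r b a"
    "\<not> r a b \<or> \<not> r b d \<or> \<not> r d a" "\<not> r a d \<or> \<not> r d b \<or> \<not> r b a"
    "\<not> r a c \<or> \<not> r c d \<or> \<not> r d a" "\<not> r a d \<or> \<not> r d c \<or> \<not> r c a"
    "\<not> r b c \<or> \<not> r c d \<or> \<not> r d b" "\<not> r b d \<or> \<not> r d c \<or> \<not> r c b"
    using tri V by blast+
  note swap = symmetrize_swap12 symmetrize_swap23 symmetrize_swap34
  note ordered = symmetrize_certificate_ordered[of r]
  note cyclic = symmetrize_certificate_cyclic[of r]
  \<comment> \<open>All 24 candidate topological orders, then the 6 cyclic orders, each rotated to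
    start at \<open>a\<close>.\<close>
  note cases =
      ordered[of a b c d] ordered[of a b d c] ordered[of a c b d] ordered[of a c d b]
      ordered[of a d b c] ordered[of a d c b] ordered[of b a c d] ordered[of b a d c]
      ordered[of b c a d] ordered[of b c d a] ordered[of b d a c] ordered[of b d c a]
      ordered[of c a b d] ordered[of c a d b] ordered[of c b a d] ordered[of c b d a]
      ordered[of c d a b] ordered[of c d b a] ordered[of d a b c] ordered[of d a c b]
      ordered[of d b a c] ordered[of d b c a] ordered[of d c a b] ordered[of d c b a]
      cyclic[of a b c d] cyclic[of a b d c] cyclic[of a c b d] cyclic[of a c d b]
      cyclic[of a d b c] cyclic[of a d c b]
  show ?thesis
    \<comment> \<open>The swap rules, used as ordered rewriting, bring all conclusions to one common
      form, so what remains is propositional in the arcs.\<close>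
    using arcs triangles cases[simplified swap] by sat
qed

lemma P4_eq_sum4:
  assumes "finite V"
    and loop: "\<And>x. (x, x) \<notin> E"
    and arc: "\<And>x y. x \<in> V \<Longrightarrow> y \<in> V \<Longrightarrow> (x, y) \<in> E \<Longrightarrow> (y, x) \<notin> E"
    and tri: "\<And>x y z. \<lbrakk>x \<in> V; y \<in> V; z \<in> V; (x, y) \<in> E; (y, z) \<in> E\<rbrakk> \<Longrightarrow> (z, x) \<notin> E"
  shows "real (P4 V E) = sum4 V (path4 (\<lambda>x y. (x, y) \<in> E))"
proof -
  let ?walk = "\<lambda>(a, b, c, d). (a, b) \<in> E \<and> (b, c) \<in> E \<and> (c, d) \<in> E"
  let ?T = "V \<times> V \<times> V \<times> V"
  have "distinct [a, b, c, d]"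
    if "a \<in> V" "b \<in> V" "c \<in> V" "d \<in> V" "(a, b) \<in> E" "(b, c) \<in> E" "(c, d) \<in> E" for a b c d
  proof -
    \<comment> \<open>Equal entries at distance 1, 2 or 3 along the walk would close a loop, a
      2-cycle or a triangle.\<close>
    have "a \<noteq> b" "b \<noteq> c" "c \<noteq> d" using loop that by metis+
    moreover have "a \<noteq> c" "b \<noteq> d" using arc that by metis+
    moreover have "a \<noteq> d" using tri that by metis
    ultimately show ?thesis by simp
  qed
  then have "{(a, b, c, d). a \<in> V \<and> b \<in> V \<and> c \<in> V \<and> d \<in> V \<and>
      distinct [a, b, c, d] \<and> (a, b) \<in> E \<and> (b, c) \<in> E \<and> (c, d) \<in> E} = {t \<in> ?T. ?walk t}"
    by blast
  then have "real (P4 V E) = (\<Sum>t\<in>?T. if ?walk t then 1 else 0)"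
    unfolding P4_def using assms(1) by (simp flip: sum.inter_filter)
  also have "\<dots> = sum4 V (path4 (\<lambda>x y. (x, y) \<in> E))"
    unfolding sum4_def path4_def by (simp add: sum.cartesian_product case_prod_unfold)
  finally show ?thesis .
qed

theorem theorem2:
  fixes V :: "'a set" and E :: "('a \<times> 'a) set" and n :: nat
  assumes "digraph V E" and "three_free V E" and "card V = n"
  shows "real (P4 V E) \<le> 4 / 75 * real n ^ 4"
proof -
  define r where "r x y \<longleftrightarrow> (x, y) \<in> E" for x y
  have fin: "finite V" and loop: "\<And>x. \<not> r x x"
    using assms(1) by (auto simp: digraph_def r_def)
  have arc: "\<not> r y x" if "x \<in> V" "y \<in> V" "r x y" for x y
    using assms(2) that loop unfolding three_free_def r_def by metis
  have tri: "\<not> r z x" if "x \<in> V" "y \<in> V" "z \<in> V" "r x y" "r y z" for x y z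
  proof
    assume "r z x"
    \<comment> \<open>\<open>three_free\<close> speaks only of distinct triples; any coincidence
      here would turn one of the three arcs into a loop.\<close>
    with that loop have "distinct [x, y, z]" by auto
    with assms(2) that \<open>r z x\<close> show False unfolding three_free_def r_def by blast
  qed
  have "24 * sum4 V (certificate r) = sum4 V (symmetrize (certificate r))"
    by (simp add: sum4_symmetrize)
  also have "\<dots> \<le> sum4 V (\<lambda>_ _ _ _. 56)"
  proof (rule sum4_mono)
    fix a b c d assume "a \<in> V" "b \<in> V" "c \<in> V" "d \<in> V"
    then show "symmetrize (certificate r) a b c d \<le> 56"
      by (rule symmetrize_certificate_le) (fact arc, fact tri)
  qed
  also have "\<dots> = 56 * real n ^ 4"
    using assms(3) by (simp add: sum4_def power4_eq_xxxx)
  finally have upper: "24 * sum4 V (certificate r) \<le> 56 * real n ^ 4" .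
  have "sum4 V (certificate r) =
      44 * sum4 V (path4 r) + 18 * sum4 V (arc_square r) + 3 * sum4 V (nonarc_square r)"
    unfolding certificate_def by (simp only: sum4_add sum4_cmult)
  moreover have "0 \<le> sum4 V (arc_square r)" "0 \<le> sum4 V (nonarc_square r)"
    unfolding arc_square_def nonarc_square_def by (rule sum4_square_nonneg)+
  \<comment> \<open>Both squares enter with positive weight, so dropping them leaves a lower
    bound.\<close>
  ultimately have "44 * sum4 V (path4 r) \<le> sum4 V (certificate r)" by simp
  with upper have "sum4 V (path4 r) \<le> 7 / 132 * real n ^ 4" by simp
  also have "\<dots> \<le> 4 / 75 * real n ^ 4" by (rule mult_right_mono) simp_all
  also have "sum4 V (path4 r) = real (P4 V E)"
    using P4_eq_sum4[OF fin loop[unfolded r_def] arc[unfolded r_def] tri[unfolded r_def]]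
    unfolding r_def by (rule sym)
  finally show ?thesis .
qed

end
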